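(* Let $f:\mathbb{N}\to\mathbb{N}$ be a non-decreasing significantly sublinear function, and let $\mathcal{G}$ be a class of graphs closed under taking subgraphs that has $f$-separators. Then $p(\mathcal{G})=\mathrm{pcol}_\star(\mathcal{G})$.
   Context: All graphs are finite and simple. A separation of $G$ is a pair $(L,R)$ of subgraphs with $G=L\cup R$; its order is $|V(L\cap R)|$. A class $\mathcal{G}$ has $f$-separators if every $G\in\mathcal{G}$ has a separation $(L,R)$ of order at most $f(|V(G)|)$ with $|V(L)\setminus V(R)|,|V(R)\setminus V(L)|\le\frac23|V(G)|$. $f$ is significantly sublinear if $\sum_{i\ge0} f((3/2)^i)/(3/2)^i<\infty$. A $t$-island in $G$ is a non-empty $S\subseteq V(G)$ such that every vertex of $S$ has fewer than $t$ neighbors in $V(G)\setminus S$. $t$-percolation: starting from an active set $A_0$, repeatedly activate any inactive vertex with at least $t$ active neighbors; $A_0$ $t$-percolates if eventually all vertices are active. $G$ is $\varepsilon$-resistant to $t$-percolation if no set of at most $\varepsilon|V(G)|$ vertices $t$-percolates. $p(\mathcal{G})$ is the minimum integer $t$ such that for some $\varepsilon>0$ all graphs in $\mathcal{G}$ with at least one vertex are $\varepsilon$-resistant to $t$-percolation; $\mathrm{pcol}_\star(\mathcal{G})$ is the minimum integer $t$ such that for some $\varepsilon>0$ every $G\in\mathcal{G}$ contains at least $\varepsilon|V(G)|$ pairwise disjoint $t$-islands (each is $\infty$ if no such $t$ exists). *)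

theory Defs
  imports
    Complex_Main
    "HOL-Library.Extended_Nat"
    "Graph_Theory.Digraph_Component"
begin

text \<open>
  Finite simple graphs are the values \<open>G :: 'a pair_pre_digraph\<close> satisfying \<open>pair_graph G\<close>: finite,
  loop-free, and with a symmetric arc relation, so that an edge \<open>uv\<close> is the pair of arcs
  \<open>(u, v)\<close> and \<open>(v, u)\<close>. Classes of graphs are sets of such values over an arbitrary
  vertex type. The library predicate \<open>subgraph\<close> does not force symmetry, hence subgraphs are
  additionally required to satisfy \<open>pair_graph\<close>.
\<close>

definition graph_class :: "'a pair_pre_digraph set \<Rightarrow> bool" where
  "graph_class \<G> \<longleftrightarrow> (\<forall>G\<in>\<G>. pair_graph G)"

definition is_subgraph :: "'a pair_pre_digraph \<Rightarrow> 'a pair_pre_digraph \<Rightarrow> bool" where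
  "is_subgraph H G \<longleftrightarrow> pair_graph H \<and> subgraph (with_proj H) (with_proj G)"

definition subgraph_closed :: "'a pair_pre_digraph set \<Rightarrow> bool" where
  "subgraph_closed \<G> \<longleftrightarrow> (\<forall>G\<in>\<G>. \<forall>H. is_subgraph H G \<longrightarrow> H \<in> \<G>)"

definition neighbors :: "'a pair_pre_digraph \<Rightarrow> 'a \<Rightarrow> 'a set" where
  "neighbors G v = {u. (v, u) \<in> parcs G}"

definition separation ::
  "'a pair_pre_digraph \<Rightarrow> 'a pair_pre_digraph \<Rightarrow> 'a pair_pre_digraph \<Rightarrow> bool" where
  "separation G L R \<longleftrightarrow> is_subgraph L G \<and> is_subgraph R G
     \<and> with_proj G = union (with_proj L) (with_proj R)"

definition separation_order :: "'a pair_pre_digraph \<Rightarrow> 'a pair_pre_digraph \<Rightarrow> nat" where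
  "separation_order L R = card (pverts L \<inter> pverts R)"

definition has_separators :: "(nat \<Rightarrow> nat) \<Rightarrow> 'a pair_pre_digraph set \<Rightarrow> bool" where
  "has_separators f \<G> \<longleftrightarrow> (\<forall>G\<in>\<G>. \<exists>L R. separation G L R
     \<and> separation_order L R \<le> f (card (pverts G))
     \<and> real (card (pverts L - pverts R)) \<le> 2 / 3 * real (card (pverts G))
     \<and> real (card (pverts R - pverts L)) \<le> 2 / 3 * real (card (pverts G)))"

text \<open>
  As \<open>f\<close> is defined on natural numbers only, the argument \<open>(3/2)\<^sup>i\<close> is rounded down. For
  non-decreasing \<open>f\<close>, rounding up gives an equivalent condition, since
  \<open>\<lceil>(3/2)\<^sup>i\<rceil> \<le> \<lfloor>(3/2)\<^sup>i\<^sup>+\<^sup>2\<rfloor>\<close>. The terms are nonnegative, so \<open>summable\<close> says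
  that the sum is finite.
\<close>

definition significantly_sublinear :: "(nat \<Rightarrow> nat) \<Rightarrow> bool" where
  "significantly_sublinear f \<longleftrightarrow>
     summable (\<lambda>i::nat. real (f (nat \<lfloor>(3 / 2 :: real) ^ i\<rfloor>)) / (3 / 2) ^ i)"

definition island :: "nat \<Rightarrow> 'a pair_pre_digraph \<Rightarrow> 'a set \<Rightarrow> bool" where
  "island t G S \<longleftrightarrow> S \<noteq> {} \<and> S \<subseteq> pverts G \<and> (\<forall>v\<in>S. card (neighbors G v - S) < t)"

text \<open>One step activates a single inactive vertex.\<close>

definition percolation_step ::
  "nat \<Rightarrow> 'a pair_pre_digraph \<Rightarrow> 'a set \<Rightarrow> 'a set \<Rightarrow> bool" where
  "percolation_step t G A B \<longleftrightarrow>
     (\<exists>v\<in>pverts G - A. t \<le> card (neighbors G v \<inter> A) \<and> B = insert v A)"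

definition percolates :: "nat \<Rightarrow> 'a pair_pre_digraph \<Rightarrow> 'a set \<Rightarrow> bool" where
  "percolates t G A \<longleftrightarrow> A \<subseteq> pverts G \<and> (percolation_step t G)\<^sup>*\<^sup>* A (pverts G)"

definition resistant :: "real \<Rightarrow> nat \<Rightarrow> 'a pair_pre_digraph \<Rightarrow> bool" where
  "resistant \<epsilon> t G \<longleftrightarrow>
     \<not> (\<exists>A\<subseteq>pverts G. real (card A) \<le> \<epsilon> * real (card (pverts G)) \<and> percolates t G A)"

text \<open>
  The parameters below range over natural \<open>t\<close>: for \<open>t \<le> 0\<close>, a non-null graph has no
  \<open>t\<close>-islands and the empty set \<open>t\<close>-percolates in it, so nonpositive \<open>t\<close> never qualify. The only
  exception are classes without non-null graphs, where every \<open>t\<close> qualifies and both parameters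
  are 0.
\<close>

definition min_or_infinity :: "(nat \<Rightarrow> bool) \<Rightarrow> enat" where
  "min_or_infinity P = (if \<exists>t. P t then enat (LEAST t. P t) else \<infinity>)"

definition percolation_threshold :: "'a pair_pre_digraph set \<Rightarrow> enat" where
  "percolation_threshold \<G> = min_or_infinity (\<lambda>t.
     \<exists>\<epsilon>>0. \<forall>G\<in>\<G>. pverts G \<noteq> {} \<longrightarrow> resistant \<epsilon> t G)"

definition pcol_star :: "'a pair_pre_digraph set \<Rightarrow> enat" where
  "pcol_star \<G> = min_or_infinity (\<lambda>t.
     \<exists>\<epsilon>>0. \<forall>G\<in>\<G>. \<exists>\<I>. (\<forall>S\<in>\<I>. island t G S) \<and> pairwise disjnt \<I>
       \<and> real (card \<I>) \<ge> \<epsilon> * real (card (pverts G)))"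

end

theory Submission
  imports Defs
begin

text \<open>
  A set of vertices percolates iff it meets every island, so the theorem compares a transversal
  number with a packing number. Applying separators recursively, a graph of the class falls apart
  into pieces of bounded size after the deletion of a set \<open>X\<close> of at most \<open>\<delta>|V|\<close> vertices.
  Indeed, splitting all subgraphs with between \<open>(3/2)\<^sup>i\<close> and \<open>(3/2)\<^sup>i\<^sup>+\<^sup>1\<close> vertices, which are
  disjoint, costs at most \<open>|V| f((3/2)\<^sup>i\<^sup>+\<^sup>1) / (3/2)\<^sup>i\<close>, and stopping at a large
  constant size leaves a tail of a convergent series.
  An island that avoids \<open>X\<close> remains an island when intersected with any piece that it meets. Hence
  \<open>X\<close> together with all pieces that contain an island meets every island; if
  the graph is resistant, then linearly many pieces contain an island.
\<close>

section \<open>Percolating sets as transversals of islands\<close>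

lemma finite_neighbors:
  assumes "pair_graph G"
  shows "finite (neighbors G v)"
proof -
  interpret pair_graph G by fact
  have "neighbors G v \<subseteq> snd ` parcs G" by (force simp: neighbors_def)
  then show ?thesis by (rule finite_subset) simp
qed

text \<open>The first activated vertex of \<open>S\<close> would have all its active neighbors
  outside \<open>S\<close>, and there are fewer than \<open>t\<close> of those. So disjointness from
  \<open>S\<close> survives every step.\<close>

lemma percolates_inter_island:
  assumes "pair_graph G" "percolates t G A" "island t G S"
  shows "A \<inter> S \<noteq> {}"
proof
  assume "A \<inter> S = {}"
  have "(percolation_step t G)\<^sup>*\<^sup>* A (pverts G)"
    using assms(2) by (simp add: percolates_def)
  then have "pverts G \<inter> S = {}"
  proof (induction rule: rtranclp_induct)
    case base
    show ?case by fact
  next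
    case (step B C)
    obtain v where v: "t \<le> card (neighbors G v \<inter> B)" "C = insert v B"
      using step.hyps(2) by (auto simp: percolation_step_def)
    have "card (neighbors G v \<inter> B) \<le> card (neighbors G v - S)"
      using step.IH finite_neighbors[OF assms(1)] by (intro card_mono) auto
    then have "v \<notin> S"
      using v(1) assms(3) by (auto simp: island_def dest!: bspec)
    then show ?case using step.IH v(2) by auto
  qed
  then show False using assms(3) by (auto simp: island_def)
qed

text \<open>As long as some vertex is inactive, the inactive set avoids \<open>A\<close> and hence
  is not an island. A vertex witnessing this can be activated, and the larger active set still meets
  every island.\<close>

lemma percolates_if_meets_islands:
  assumes "pair_graph G" "A \<subseteq> pverts G" "\<And>S. island t G S \<Longrightarrow> A \<inter> S \<noteq> {}"
  shows "percolates t G A"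
proof -
  interpret pair_graph G by fact
  have "(percolation_step t G)\<^sup>*\<^sup>* A (pverts G)"
    using assms(2,3)
  proof (induction "card (pverts G - A)" arbitrary: A rule: less_induct)
    case less
    show ?case
    proof (cases "A = pverts G")
      case False
      have "\<not> island t G (pverts G - A)" using less.prems(2) by blast
      then obtain v where v: "v \<in> pverts G - A" "t \<le> card (neighbors G v - (pverts G - A))"
        using False less.prems(1) by (force simp: island_def not_less)
      have "neighbors G v - (pverts G - A) = neighbors G v \<inter> A"
        using less.prems(1) in_arcsD2 by (auto simp: neighbors_def)
      with v have step: "percolation_step t G A (insert v A)"
        by (auto simp: percolation_step_def)
      have "(percolation_step t G)\<^sup>*\<^sup>* (insert v A) (pverts G)"
      proof (rule less.hyps)
        show "card (pverts G - insert v A) < card (pverts G - A)"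
          using v(1) by (intro psubset_card_mono) auto
      qed (use v(1) less.prems in auto)
      with step show ?thesis by (rule converse_rtranclp_into_rtranclp)
    qed simp
  qed
  with assms(2) show ?thesis by (simp add: percolates_def)
qed

text \<open>Weak duality: choosing a vertex of \<open>A\<close> in each island is injective by
  disjointness. The injection into the finite set \<open>A\<close> also excludes an infinite family,
  whose \<open>card\<close> would be 0.\<close>

lemma card_disjoint_islands_le:
  assumes "pair_graph G" "percolates t G A" "\<forall>S\<in>\<I>. island t G S" "pairwise disjnt \<I>"
  shows "card \<I> \<le> card A"
proof -
  interpret pair_graph G by fact
  have "finite A"
    using assms(2) by (auto simp: percolates_def intro: finite_subset)
  have "\<forall>S\<in>\<I>. \<exists>a. a \<in> A \<inter> S"
    using percolates_inter_island[OF assms(1,2)] assms(3) by blast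
  then obtain h where h: "\<And>S. S \<in> \<I> \<Longrightarrow> h S \<in> A \<inter> S" by metis
  have "inj_on h \<I>"
  proof (rule inj_onI, rule ccontr)
    fix S T assume ST: "S \<in> \<I>" "T \<in> \<I>" "h S = h T" "S \<noteq> T"
    then have "h S \<in> S \<inter> T" using h[of S] h[of T] by simp
    with ST pairwiseD[OF assms(4)] show False by (auto simp: disjnt_iff)
  qed
  then show ?thesis
    using h \<open>finite A\<close> by (intro card_inj_on_le) auto
qed

section \<open>Fragmentation by recursive separation\<close>

definition fragmentation :: "nat \<Rightarrow> 'a pair_pre_digraph \<Rightarrow> 'a set \<Rightarrow> 'a set set \<Rightarrow> bool" where
  "fragmentation K G X P \<longleftrightarrow> X \<subseteq> pverts G \<and> \<Union>P = pverts G - X \<and> pairwise disjnt P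
     \<and> (\<forall>C\<in>P. card C \<le> K \<and> (\<forall>v\<in>C. neighbors G v \<subseteq> C \<union> X))"

definition induced :: "'a pair_pre_digraph \<Rightarrow> 'a set \<Rightarrow> 'a pair_pre_digraph" where
  "induced G A = \<lparr>pverts = A, parcs = parcs G \<inter> A \<times> A\<rparr>"

lemma is_subgraph_induced:
  assumes "pair_graph G" "A \<subseteq> pverts G"
  shows "is_subgraph (induced G A) G"
proof -
  interpret pair_graph G by fact
  have "finite A" using assms(2) pair_finite_verts by (rule finite_subset)
  then have "pair_graph (induced G A)"
    using pair_finite_arcs
    by unfold_locales
      (auto simp: induced_def symmetric_def intro!: symI intro: arcs_symmetric dest: pair_no_loops)
  then interpret H: pair_graph "induced G A" .
  show ?thesis
    using assms(2) H.pair_graph_axioms H.wf_digraph_axioms wf_digraph_axioms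
    by (auto simp: is_subgraph_def subgraph_def compatibleI_with_proj induced_def)
qed

text \<open>Every edge lies in \<open>L\<close> or in \<open>R\<close>, so none joins the two open
  sides. A neighbor of a vertex on one side is therefore on the same side, where the given
  fragmentation controls it, or in the separator, which is deleted.\<close>

lemma fragmentation_separation:
  assumes sep: "separation G L R"
    and A: "fragmentation K (induced G (pverts L - pverts R)) X P"
    and B: "fragmentation K (induced G (pverts R - pverts L)) Y Q"
  shows "fragmentation K G (pverts L \<inter> pverts R \<union> X \<union> Y) (P \<union> Q)"
proof -
  have V: "pverts G = pverts L \<union> pverts R" and E: "parcs G = parcs L \<union> parcs R"
    using sep by (auto simp: separation_def union_def with_proj_def)
  have L: "u \<in> pverts L" "v \<in> pverts L" if "(u, v) \<in> parcs L" for u v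
    using sep that pair_wf_digraph.in_arcsD1 pair_wf_digraph.in_arcsD2
    by (auto simp: separation_def is_subgraph_def pair_graph_def pair_digraph_def pair_fin_digraph_def)
  have R: "u \<in> pverts R" "v \<in> pverts R" if "(u, v) \<in> parcs R" for u v
    using sep that pair_wf_digraph.in_arcsD1 pair_wf_digraph.in_arcsD2
    by (auto simp: separation_def is_subgraph_def pair_graph_def pair_digraph_def pair_fin_digraph_def)
  have P: "X \<subseteq> pverts L - pverts R" "\<Union>P = pverts L - pverts R - X" "pairwise disjnt P"
      "\<And>C. C \<in> P \<Longrightarrow> card C \<le> K"
      "\<And>C v. C \<in> P \<Longrightarrow> v \<in> C \<Longrightarrow> neighbors (induced G (pverts L - pverts R)) v \<subseteq> C \<union> X"
    using A by (simp_all add: fragmentation_def induced_def)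
  have Q: "Y \<subseteq> pverts R - pverts L" "\<Union>Q = pverts R - pverts L - Y" "pairwise disjnt Q"
      "\<And>C. C \<in> Q \<Longrightarrow> card C \<le> K"
      "\<And>C v. C \<in> Q \<Longrightarrow> v \<in> C \<Longrightarrow> neighbors (induced G (pverts R - pverts L)) v \<subseteq> C \<union> Y"
    using B by (simp_all add: fragmentation_def induced_def)
  have nP: "neighbors G v \<subseteq> C \<union> (pverts L \<inter> pverts R \<union> X \<union> Y)" if "C \<in> P" "v \<in> C" for C v
  proof
    fix u assume u: "u \<in> neighbors G v"
    have v: "v \<in> pverts L - pverts R" using that P(2) by blast
    with u have "(v, u) \<in> parcs L" using E R by (auto simp: neighbors_def)
    with v have "u \<in> pverts R \<or> u \<in> neighbors (induced G (pverts L - pverts R)) v" "u \<in> pverts L"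
      using E L by (auto simp: neighbors_def induced_def)
    then show "u \<in> C \<union> (pverts L \<inter> pverts R \<union> X \<union> Y)" using P(5)[OF that] by blast
  qed
  have nQ: "neighbors G v \<subseteq> C \<union> (pverts L \<inter> pverts R \<union> X \<union> Y)" if "C \<in> Q" "v \<in> C" for C v
  proof
    fix u assume u: "u \<in> neighbors G v"
    have v: "v \<in> pverts R - pverts L" using that Q(2) by blast
    with u have "(v, u) \<in> parcs R" using E L by (auto simp: neighbors_def)
    with v have "u \<in> pverts L \<or> u \<in> neighbors (induced G (pverts R - pverts L)) v" "u \<in> pverts R"
      using E R by (auto simp: neighbors_def induced_def)
    then show "u \<in> C \<union> (pverts L \<inter> pverts R \<union> X \<union> Y)" using Q(5)[OF that] by blast
  qed
  have "disjnt C D" if "C \<in> P" "D \<in> Q" for C D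
    using that P(2) Q(2) by (auto simp: disjnt_iff)
  then have "pairwise disjnt (P \<union> Q)"
    using P(3) Q(3) by (auto simp: pairwise_def disjnt_sym)
  moreover have "\<Union>(P \<union> Q) = pverts G - (pverts L \<inter> pverts R \<union> X \<union> Y)"
    using P(1,2) Q(1,2) V by (auto simp: Union_Un_distrib)
  moreover have "pverts L \<inter> pverts R \<union> X \<union> Y \<subseteq> pverts G"
    using P(1) Q(1) V by blast
  ultimately show ?thesis
    using P(4) Q(4) nP nQ unfolding fragmentation_def by (meson UnE)
qed

text \<open>Induction on the number \<open>j\<close> of size levels above the stopping level
  \<open>m\<close>. Each level adds one summand, the cost of its separators per vertex of the graph;
  the factor 3/2 is the ratio between the largest and smallest size within a level.\<close>

lemma fragmentation_level:
  assumes "mono f" "graph_class \<G>" "subgraph_closed \<G>" "has_separators f \<G>"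
    and "G \<in> \<G>" "real (card (pverts G)) \<le> (3 / 2) ^ (m + j)"
  shows "\<exists>X P. fragmentation (nat \<lfloor>(3 / 2 :: real) ^ m\<rfloor>) G X P
    \<and> real (card X) \<le> real (card (pverts G)) *
        (3 / 2 * (\<Sum>i<j. real (f (nat \<lfloor>(3 / 2 :: real) ^ (i + Suc m)\<rfloor>)) / (3 / 2) ^ (i + Suc m)))"
  using assms(5,6)
proof (induction j arbitrary: G)
  case 0
  interpret pair_graph G using 0 assms(2) by (auto simp: graph_class_def)
  have "card (pverts G) \<le> nat \<lfloor>(3 / 2 :: real) ^ m\<rfloor>"
    using 0 by (simp add: le_nat_floor)
  \<comment> \<open>The whole graph is one piece; for the null graph this piece is empty, which
    \<open>fragmentation\<close> permits.\<close>
  then have "fragmentation (nat \<lfloor>(3 / 2 :: real) ^ m\<rfloor>) G {} {pverts G}"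
    using in_arcsD2 by (auto simp: fragmentation_def neighbors_def)
  then show ?case by force
next
  case (Suc j)
  define K where "K = nat \<lfloor>(3 / 2 :: real) ^ m\<rfloor>"
  define e where "e i = real (f (nat \<lfloor>(3 / 2 :: real) ^ (i + Suc m)\<rfloor>)) / (3 / 2) ^ (i + Suc m)" for i
  define c where "c = 3 / 2 * (\<Sum>i<j. e i)"
  let ?n = "real (card (pverts G))"
  have IH: "\<exists>X P. fragmentation K H X P \<and> real (card X) \<le> real (card (pverts H)) * c"
    if "H \<in> \<G>" "real (card (pverts H)) \<le> (3 / 2) ^ (m + j)" for H
    using Suc.IH[OF that] by (simp add: K_def c_def e_def)
  have e_nonneg: "e j \<ge> 0" by (simp add: e_def)
  have sum_e: "3 / 2 * (\<Sum>i<Suc j. e i) = c + 3 / 2 * e j"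
    by (simp add: c_def algebra_simps)
  have "\<exists>X P. fragmentation K G X P \<and> real (card X) \<le> ?n * (c + 3 / 2 * e j)"
  \<comment> \<open>A graph that already fits the lower level is not split: only the failure of this
    bound makes \<open>?n\<close> large enough to pay for a separator.\<close>
  proof (cases "?n \<le> (3 / 2) ^ (m + j)")
    case True
    have "?n * c \<le> ?n * (c + 3 / 2 * e j)"
      using e_nonneg by (intro mult_left_mono) auto
    with IH[OF Suc.prems(1) True] show ?thesis by force
  next
    case False
    interpret pair_graph G using Suc.prems assms(2) by (auto simp: graph_class_def)
    obtain L R where sep: "separation G L R" "card (pverts L \<inter> pverts R) \<le> f (card (pverts G))"
      and cA: "real (card (pverts L - pverts R)) \<le> 2 / 3 * ?n"
      and cB: "real (card (pverts R - pverts L)) \<le> 2 / 3 * ?n"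
      using assms(4) Suc.prems(1) unfolding has_separators_def separation_order_def by blast
    define A B where "A = pverts L - pverts R" and "B = pverts R - pverts L"
    have G: "pverts G = pverts L \<union> pverts R"
      using sep(1) by (auto simp: separation_def dest!: arg_cong[of _ _ verts])
    have small: "2 / 3 * ?n \<le> (3 / 2) ^ (m + j)" using Suc.prems(2) by simp
    have AB: "induced G A \<in> \<G>" "induced G B \<in> \<G>"
      using is_subgraph_induced[OF pair_graph_axioms] assms(3) Suc.prems(1) G
      by (auto simp: subgraph_closed_def A_def B_def)
    obtain X P where X: "fragmentation K (induced G A) X P" "real (card X) \<le> real (card A) * c"
      using IH[OF AB(1)] cA small by (auto simp: A_def induced_def)
    obtain Y Q where Y: "fragmentation K (induced G B) Y Q" "real (card Y) \<le> real (card B) * c"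
      using IH[OF AB(2)] cB small by (auto simp: B_def induced_def)
    have frag: "fragmentation K G (pverts L \<inter> pverts R \<union> X \<union> Y) (P \<union> Q)"
      using fragmentation_separation sep(1) X(1) Y(1) by (auto simp: A_def B_def)
    have "card (pverts G) \<le> nat \<lfloor>(3 / 2 :: real) ^ (j + Suc m)\<rfloor>"
      using Suc.prems(2) by (simp add: le_nat_floor ac_simps)
    then have "real (f (card (pverts G))) \<le> real (f (nat \<lfloor>(3 / 2 :: real) ^ (j + Suc m)\<rfloor>))"
      using assms(1) by (simp add: monoD)
    \<comment> \<open>The denominator of \<open>e j\<close> is the upper end of the level, 3/2 times
      the lower end that bounds \<open>?n\<close> from below.\<close>
    also have "\<dots> = (3 / 2) ^ (m + j) * (3 / 2 * e j)"
      by (simp add: e_def power_add)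
    also have "\<dots> \<le> ?n * (3 / 2 * e j)"
      using False e_nonneg by (intro mult_right_mono) auto
    finally have Z: "real (card (pverts L \<inter> pverts R)) \<le> ?n * (3 / 2 * e j)"
      using sep(2) by linarith
    \<comment> \<open>The two sides are disjoint, so their recursive costs together stay within
      \<open>?n * c\<close>.\<close>
    have "card (A \<union> B) \<le> card (pverts G)"
      using G pair_finite_verts by (intro card_mono) (auto simp only: A_def B_def)
    moreover have "card (A \<union> B) = card A + card B"
      using pair_finite_verts unfolding G A_def B_def by (intro card_Un_disjoint) auto
    ultimately have "(real (card A) + real (card B)) * c \<le> ?n * c"
      by (intro mult_right_mono) (auto simp: c_def e_def intro!: sum_nonneg)
    moreover have "card (pverts L \<inter> pverts R \<union> X \<union> Y) \<le> card (pverts L \<inter> pverts R) + card X + card Y"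
      by (meson add_right_mono card_Un_le le_trans)
    ultimately have "real (card (pverts L \<inter> pverts R \<union> X \<union> Y)) \<le> ?n * (c + 3 / 2 * e j)"
      using X(2) Y(2) Z by (simp add: algebra_simps)
    with frag show ?thesis by blast
  qed
  then show ?case unfolding sum_e[symmetric] unfolding K_def e_def .
qed

text \<open>The number of levels depends on the graph, but the tail of the convergent series bounds
  the cost for all of them at once. Hence the stopping level, and with it \<open>K\<close>, depends
  only on \<delta> and \<open>f\<close>.\<close>

lemma fragmentation_exists:
  fixes \<delta> :: real
  assumes "mono f" "significantly_sublinear f" "graph_class \<G>" "subgraph_closed \<G>"
    "has_separators f \<G>" "\<delta> > 0"
  shows "\<exists>K>0. \<forall>G\<in>\<G>. \<exists>X P. fragmentation K G X P \<and> real (card X) \<le> \<delta> * real (card (pverts G))"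
proof -
  define e where "e i = real (f (nat \<lfloor>(3 / 2 :: real) ^ i\<rfloor>)) / (3 / 2) ^ i" for i
  have summable: "summable e"
    using assms(2) by (simp add: significantly_sublinear_def e_def[abs_def])
  \<comment> \<open>The factor 2/3 cancels the 3/2 in the bound of
    \<open>fragmentation_level\<close>.\<close>
  obtain N where N: "\<And>n. n \<ge> N \<Longrightarrow> norm (\<Sum>i. e (i + n)) < 2 / 3 * \<delta>"
    using suminf_exist_split[OF _ summable, of "2 / 3 * \<delta>"] assms(6) by auto
  define K where "K = nat \<lfloor>(3 / 2 :: real) ^ N\<rfloor>"
  have "(1::real) \<le> (3 / 2) ^ N" by simp
  then have "K > 0" by (simp add: K_def)
  moreover have "\<exists>X P. fragmentation K G X P \<and> real (card X) \<le> \<delta> * real (card (pverts G))"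
    if "G \<in> \<G>" for G
  proof -
    obtain j where "real (card (pverts G)) < (3 / 2) ^ j"
      using real_arch_pow[of "3 / 2 :: real"] by auto
    also have "\<dots> \<le> (3 / 2) ^ (N + j)" by (intro power_increasing) auto
    finally have "real (card (pverts G)) \<le> (3 / 2) ^ (N + j)" by simp
    then obtain X P where XP: "fragmentation K G X P"
      "real (card X) \<le> real (card (pverts G)) * (3 / 2 * (\<Sum>i<j. e (i + Suc N)))"
      using fragmentation_level[OF assms(1,3-5) \<open>G \<in> \<G>\<close>] unfolding K_def e_def by blast
    have "(\<Sum>i<j. e (i + Suc N)) \<le> (\<Sum>i. e (i + Suc N))"
      by (intro sum_le_suminf summable_ignore_initial_segment summable) (simp_all add: e_def)
    also have "\<dots> < 2 / 3 * \<delta>" using N[of "Suc N"] by simp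
    finally have "3 / 2 * (\<Sum>i<j. e (i + Suc N)) \<le> \<delta>" by simp
    then have "real (card X) \<le> real (card (pverts G)) * \<delta>"
      using XP(2) by (meson mult_left_mono of_nat_0_le_iff order_trans)
    with XP(1) show ?thesis by (auto simp: mult.commute)
  qed
  ultimately show ?thesis by blast
qed

section \<open>From resistance to many disjoint islands\<close>

lemma island_Int_fragment:
  assumes "fragmentation K G X P" "C \<in> P" "island t G S" "S \<inter> X = {}" "S \<inter> C \<noteq> {}"
  shows "island t G (S \<inter> C)"
proof -
  have "card (neighbors G v - S \<inter> C) < t" if "v \<in> S \<inter> C" for v
  proof -
    have "neighbors G v \<subseteq> C \<union> X"
      using assms(1,2) that unfolding fragmentation_def by blast
    \<comment> \<open>A neighbor in \<open>S\<close> is not in \<open>X\<close>, so it lies in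
      \<open>C\<close>: cutting \<open>S\<close> down to \<open>C\<close> loses no neighbors of
      \<open>v\<close>.\<close>
    then have "neighbors G v - S \<inter> C = neighbors G v - S" using assms(4) by blast
    then show ?thesis using assms(3) that by (simp add: island_def)
  qed
  then show ?thesis using assms(3,5) by (auto simp: island_def)
qed

text \<open>The percolating set built from \<open>X\<close> and the pieces containing islands
  exceeds the resistance bound. Since \<open>X\<close> uses at most half of that bound, these pieces
  cover the other half, with at most \<open>K\<close> vertices each.\<close>

lemma islands_if_resistant:
  assumes "pair_graph G" "pverts G \<noteq> {}" "resistant \<epsilon> t G" "fragmentation K G X P" "K > 0"
    "real (card X) \<le> \<epsilon> / 2 * real (card (pverts G))"
  shows "\<exists>\<I>. (\<forall>S\<in>\<I>. island t G S) \<and> pairwise disjnt \<I>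
    \<and> real (card \<I>) \<ge> \<epsilon> / 2 / real K * real (card (pverts G))"
proof -
  interpret pair_graph G by fact
  define Q where "Q = {C \<in> P. \<exists>S\<subseteq>C. island t G S}"
  define A where "A = X \<union> \<Union>Q"
  have sub: "X \<subseteq> pverts G" "\<Union>P = pverts G - X" and disj: "pairwise disjnt P"
    and K: "\<And>C. C \<in> P \<Longrightarrow> card C \<le> K"
    using assms(4) by (auto simp: fragmentation_def)
  have "A \<subseteq> pverts G" using sub by (auto simp: A_def Q_def)
  moreover have "percolates t G A"
  proof (rule percolates_if_meets_islands[OF assms(1) \<open>A \<subseteq> pverts G\<close>])
    fix S assume S: "island t G S"
    show "A \<inter> S \<noteq> {}"
    proof (cases "S \<inter> X = {}")
      case True
      obtain v where "v \<in> S" "v \<in> pverts G" using S by (auto simp: island_def)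
      with True sub obtain C where C: "C \<in> P" "v \<in> C" by blast
      then have "island t G (S \<inter> C)"
        using island_Int_fragment[OF assms(4) C(1) S True] \<open>v \<in> S\<close> by blast
      then have "C \<in> Q" using C(1) by (auto simp: Q_def)
      with C \<open>v \<in> S\<close> show ?thesis by (auto simp: A_def)
    qed (auto simp: A_def)
  qed
  ultimately have big: "real (card A) > \<epsilon> * real (card (pverts G))"
    using assms(3) by (auto simp: resistant_def not_le)
  have "finite (\<Union>P)" using sub(2) by simp
  then have "finite Q" by (auto dest: finite_UnionD simp: Q_def)
  have "card A \<le> card X + card (\<Union>Q)" by (simp add: A_def card_Un_le)
  also have "card (\<Union>Q) \<le> (\<Sum>C\<in>Q. card C)" by (rule card_Union_le_sum_card)
  also have "\<dots> \<le> card Q * K" using K by (intro sum_bounded_above[THEN order_trans]) (auto simp: Q_def)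
  finally have "card A \<le> card X + card Q * K" by simp
  then have "real (card A) \<le> real (card X) + real (card Q) * real K"
    by (metis of_nat_add of_nat_le_iff of_nat_mult)
  then have "\<epsilon> / 2 * real (card (pverts G)) \<le> real (card Q) * real K"
    using big assms(6) by (simp add: field_simps)
  then have many: "\<epsilon> / 2 / real K * real (card (pverts G)) \<le> real (card Q)"
    using assms(5) by (simp add: field_simps)
  have "\<forall>C\<in>Q. \<exists>S. S \<subseteq> C \<and> island t G S" by (auto simp: Q_def)
  then obtain h where h: "\<And>C. C \<in> Q \<Longrightarrow> h C \<subseteq> C \<and> island t G (h C)" by metis
  have h_disj: "disjnt (h C) (h D)" if "C \<in> Q" "D \<in> Q" "C \<noteq> D" for C D
    using that h[of C] h[of D] pairwiseD[OF disj, of C D]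
    by (auto simp: Q_def intro: disjnt_subset1 disjnt_subset2)
  \<comment> \<open>Equal values on distinct pieces would be an island disjoint from itself, hence
    empty.\<close>
  have "inj_on h Q"
    using h_disj h by (metis disjnt_self_iff_empty inj_onI island_def)
  then have "card (h ` Q) = card Q" by (rule card_image)
  moreover have "pairwise disjnt (h ` Q)"
    using h_disj by (auto simp: pairwise_def)
  ultimately show ?thesis
    using h many by (intro exI[of _ "h ` Q"]) auto
qed

theorem theorem23:
  fixes f :: "nat \<Rightarrow> nat" and \<G> :: "'a pair_pre_digraph set"
  assumes "mono f"
    and "significantly_sublinear f"
    and "graph_class \<G>"
    and "subgraph_closed \<G>"
    and "has_separators f \<G>"
  shows "percolation_threshold \<G> = pcol_star \<G>"
proof -
  \<comment> \<open>The two conditions agree for each single \<open>t\<close>, with different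
    constants \<epsilon>, so the minima agree, including the infinite case.\<close>
  have "(\<exists>\<epsilon>>0. \<forall>G\<in>\<G>. pverts G \<noteq> {} \<longrightarrow> resistant \<epsilon> t G) \<longleftrightarrow>
    (\<exists>\<epsilon>>0. \<forall>G\<in>\<G>. \<exists>\<I>. (\<forall>S\<in>\<I>. island t G S) \<and> pairwise disjnt \<I>
       \<and> real (card \<I>) \<ge> \<epsilon> * real (card (pverts G)))" (is "?P \<longleftrightarrow> ?Q") for t
  proof
    assume ?P
    then obtain \<epsilon> where \<epsilon>: "\<epsilon> > 0" "\<And>G. G \<in> \<G> \<Longrightarrow> pverts G \<noteq> {} \<Longrightarrow> resistant \<epsilon> t G" by blast
    obtain K where K: "K > 0"
      "\<And>G. G \<in> \<G> \<Longrightarrow> \<exists>X P. fragmentation K G X P \<and> real (card X) \<le> \<epsilon> / 2 * real (card (pverts G))"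
      using fragmentation_exists[OF assms, of "\<epsilon> / 2"] \<epsilon>(1) by auto
    have "\<exists>\<I>. (\<forall>S\<in>\<I>. island t G S) \<and> pairwise disjnt \<I>
       \<and> real (card \<I>) \<ge> \<epsilon> / 2 / real K * real (card (pverts G))" if "G \<in> \<G>" for G
    proof (cases "pverts G = {}")
      case True
      then show ?thesis by (intro exI[of _ "{}"]) simp
    next
      case False
      have "pair_graph G" using assms(3) that by (simp add: graph_class_def)
      then show ?thesis
        using islands_if_resistant[OF _ False \<epsilon>(2)[OF that False] _ K(1)] K(2)[OF that] by blast
    qed
    moreover have "\<epsilon> / 2 / real K > 0" using \<epsilon>(1) K(1) by simp
    ultimately show ?Q by blast
  next
    assume ?Q
    then obtain \<epsilon> where \<epsilon>: "\<epsilon> > 0" and isl: "\<And>G. G \<in> \<G> \<Longrightarrow> \<exists>\<I>. (\<forall>S\<in>\<I>. island t G S)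
      \<and> pairwise disjnt \<I> \<and> real (card \<I>) \<ge> \<epsilon> * real (card (pverts G))" by blast
    \<comment> \<open>Halving gives a strict gap: a percolating set has at least \<epsilon> times
      \<open>card (pverts G)\<close> vertices, and resistance also forbids equality with its
      bound.\<close>
    have "resistant (\<epsilon> / 2) t G" if G: "G \<in> \<G>" "pverts G \<noteq> {}" for G
      unfolding resistant_def
    proof safe
      fix A assume A: "real (card A) \<le> \<epsilon> / 2 * real (card (pverts G))" "percolates t G A"
      interpret pair_graph G using assms(3) G(1) by (simp add: graph_class_def)
      obtain \<I> where \<I>: "\<forall>S\<in>\<I>. island t G S" "pairwise disjnt \<I>"
        "real (card \<I>) \<ge> \<epsilon> * real (card (pverts G))" using isl[OF G(1)] by blast
      have "real (card \<I>) \<le> real (card A)"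
        using card_disjoint_islands_le[OF pair_graph_axioms A(2) \<I>(1,2)] by simp
      moreover have "\<epsilon> * real (card (pverts G)) > 0"
        using \<epsilon> G(2) by (simp add: card_gt_0_iff)
      ultimately show False using A(1) \<I>(3) by simp
    qed
    moreover have "\<epsilon> / 2 > 0" using \<epsilon> by simp
    ultimately show ?P by blast
  qed
  then show ?thesis
    by (simp add: percolation_threshold_def pcol_star_def)
qed

end
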